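(* Let $D\ge 2$ and $p\ge 1$ be integers. For every bubble $\mathcal{B}$ with $p$ black vertices (and $p$ white vertices) there exists an edge-colored map $\mathcal{M}\in\mathbb{M}_p$ (an edge-colored map with $p$ cilia) whose boundary graph satisfies $\partial\mathcal{M}=\mathcal{B}$. In other words, the boundary map $\partial:\mathbb{M}_p\to\mathbb{B}_p$ is surjective onto the set $\mathbb{B}_p$ of bubbles with $p$ black vertices; under $\partial$, each cilium of an edge-colored map corresponds to a pair $\{v,\bar v\}$ (one white, one black) of vertices of the boundary bubble.
   Context: Write $[D]=\{1,\dots,D\}$. A bubble is a finite connected bipartite graph (multiple edges allowed) whose edges each carry a color in $[D]$, such that every vertex is incident to exactly one edge of each color $1,\dots,D$. $\mathbb{B}_p$ is the set of bubbles with $p$ black and $p$ white vertices. An edge-colored map is a connected combinatorial map (graph with a rotation system, i.e. a cyclic order of half-edges around each vertex; loops and multiple edges allowed) in which every edge carries a color in $[D]$; the coloring need not be proper. A cilium is a marker placed in a corner of a vertex, at most one per vertex; it splits that corner into two corners. $\mathbb{M}_p$ is the set of edge-colored maps with exactly $p$ cilia. For $i\in[D]$, the monochromatic submap $\mathcal{M}^{(i)}$ is obtained by deleting all edges whose color is not $i$, keeping all vertices, cilia and induced cyclic orders. Going around the boundary of $\mathcal{M}^{(i)}$ (turning clockwise around each vertex; formally the cycles of $\alpha^{(i)}\sigma^{(i)}$, with $\sigma^{(i)}$ the rotation restricted to half-edges of color $i$ and cilia and $\alpha^{(i)}$ the involution pairing half-edges into edges and fixing cilia) one obtains cyclic sequences.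 Those containing a cilium are cut at each cilium into broken faces of color $i$: walks from one cilium to the next (possibly the same one), oriented by the traversal. A broken face is trivial if it traverses no edge. The boundary graph $\partial\mathcal{M}$ of $\mathcal{M}\in\mathbb{M}_p$ is constructed as follows: for each ciliated vertex $V$ of $\mathcal{M}$ create a white vertex $v$ and a black vertex $\bar v$; for each non-trivial broken face of color $i$ going from the cilium at $V$ to the cilium at $V'$ draw an edge of color $i$ between $v$ (white, from $V$) and $\bar v'$ (black, from $V'$); finally for each $V$ and each color $i$ not yet incident to $v$, add an edge of color $i$ between $v$ and $\bar v$. The pairs $\{v,\bar v\}$ form the pairing of $\partial\mathcal{M}$ induced by $\mathcal{M}$.
   Formalization: The boundary graph of a connected edge-colored map can be disconnected (path V1–U–V2 with edge colors 1, 2 and cilia at V1, V2), so ∂ does not always land in B_p; it is shown only that ∂M satisfies the definition of a bubble apart from connectedness. *)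

theory Defs
  imports Main "HOL-Combinatorics.Orbits" "HOL-Library.Disjoint_Sets"
begin

section \<open>Bubbles\<close>

text \<open>A bipartite multigraph with a given black/white vertex colouring. Edges are
  objects of their own, so parallel edges are allowed.\<close>

record ('v, 'e) cgraph =
  white :: "'v set"
  black :: "'v set"
  edges :: "'e set"
  white_end :: "'e \<Rightarrow> 'v"
  black_end :: "'e \<Rightarrow> 'v"
  edge_color :: "'e \<Rightarrow> nat"

definition colored_graph :: "nat \<Rightarrow> ('v, 'e) cgraph \<Rightarrow> bool" where
  "colored_graph D G \<longleftrightarrow>
     finite (white G) \<and> finite (black G) \<and> finite (edges G) \<and>
     white G \<inter> black G = {} \<and>
     (\<forall>e\<in>edges G. white_end G e \<in> white G \<and> black_end G e \<in> black G \<and>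
        edge_color G e \<in> {1..D})"

definition color_regular :: "nat \<Rightarrow> ('v, 'e) cgraph \<Rightarrow> bool" where
  "color_regular D G \<longleftrightarrow>
     (\<forall>v\<in>white G \<union> black G. \<forall>i\<in>{1..D}.
        \<exists>!e. e \<in> edges G \<and> edge_color G e = i \<and> (white_end G e = v \<or> black_end G e = v))"

definition adjacency :: "('v, 'e) cgraph \<Rightarrow> ('v \<times> 'v) set" where
  "adjacency G = (\<Union>e\<in>edges G. {(white_end G e, black_end G e), (black_end G e, white_end G e)})"

definition connected_cgraph :: "('v, 'e) cgraph \<Rightarrow> bool" where
  "connected_cgraph G \<longleftrightarrow>
     (\<forall>u\<in>white G \<union> black G. \<forall>v\<in>white G \<union> black G. (u, v) \<in> (adjacency G)\<^sup>*)"

definition regular_graphs :: "nat \<Rightarrow> nat \<Rightarrow> ('v, 'e) cgraph set" where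
  "regular_graphs D p =
     {G. colored_graph D G \<and> color_regular D G \<and> card (black G) = p \<and> card (white G) = p}"

definition bubbles :: "nat \<Rightarrow> nat \<Rightarrow> ('v, 'e) cgraph set" where
  "bubbles D p = {G \<in> regular_graphs D p. connected_cgraph G}"

definition cgraph_iso :: "('v, 'e) cgraph \<Rightarrow> ('w, 'f) cgraph \<Rightarrow> bool" (infix "\<simeq>\<^sub>c" 50) where
  "G \<simeq>\<^sub>c G' \<longleftrightarrow>
     (\<exists>f g. bij_betw f (white G) (white G') \<and> bij_betw f (black G) (black G') \<and>
        bij_betw g (edges G) (edges G') \<and>
        (\<forall>e\<in>edges G. white_end G' (g e) = f (white_end G e) \<and>
           black_end G' (g e) = f (black_end G e) \<and>
           edge_color G' (g e) = edge_color G e))"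

definition is_pairing :: "('v, 'e) cgraph \<Rightarrow> 'v set set \<Rightarrow> bool" where
  "is_pairing G P \<longleftrightarrow> partition_on (white G \<union> black G) P \<and>
     (\<forall>X\<in>P. \<exists>v\<in>white G. \<exists>w\<in>black G. X = {v, w})"

section \<open>Edge-colored maps\<close>

text \<open>The vertices are the cycles of the rotation \<open>rot\<close> on half-edges and cilia, so
  every vertex carries a half-edge or a cilium; in a connected map with at least one cilium
  this excludes nothing. \<open>flip\<close> pairs the half-edges into edges and fixes the cilia.\<close>

record 'd cmap =
  half_edges :: "'d set"
  cilia :: "'d set"
  rot :: "'d \<Rightarrow> 'd"
  flip :: "'d \<Rightarrow> 'd"
  dart_color :: "'d \<Rightarrow> nat"

definition vertex_of :: "'d cmap \<Rightarrow> 'd \<Rightarrow> 'd set" where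
  "vertex_of M x = orbit (rot M) x"

definition vertices :: "'d cmap \<Rightarrow> 'd set set" where
  "vertices M = vertex_of M ` (half_edges M \<union> cilia M)"

definition connected_cmap :: "'d cmap \<Rightarrow> bool" where
  "connected_cmap M \<longleftrightarrow>
     (\<forall>U\<in>vertices M. \<forall>V\<in>vertices M.
        (U, V) \<in> ((\<lambda>h. (vertex_of M h, vertex_of M (flip M h))) ` half_edges M)\<^sup>*)"

definition edge_colored_map :: "nat \<Rightarrow> 'd cmap \<Rightarrow> bool" where
  "edge_colored_map D M \<longleftrightarrow>
     finite (half_edges M) \<and> finite (cilia M) \<and> half_edges M \<inter> cilia M = {} \<and>
     rot M permutes (half_edges M \<union> cilia M) \<and>
     flip M permutes half_edges M \<and>
     (\<forall>h\<in>half_edges M. flip M h \<noteq> h \<and> flip M (flip M h) = h) \<and>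
     (\<forall>h\<in>half_edges M. dart_color M h \<in> {1..D} \<and> dart_color M (flip M h) = dart_color M h) \<and>
     (\<forall>V\<in>vertices M. card (V \<inter> cilia M) \<le> 1) \<and>
     connected_cmap M"

definition edge_colored_maps :: "nat \<Rightarrow> nat \<Rightarrow> 'd cmap set" where
  "edge_colored_maps D p = {M. edge_colored_map D M \<and> card (cilia M) = p}"

section \<open>Broken faces and the boundary graph\<close>

definition first_return :: "('a \<Rightarrow> 'a) \<Rightarrow> 'a set \<Rightarrow> 'a \<Rightarrow> 'a" where
  "first_return f S x = (f ^^ (LEAST n. 0 < n \<and> (f ^^ n) x \<in> S)) x"

text \<open>Deleting elements from a cyclic order leaves the first-return permutation on the
  remaining ones.\<close>

definition mono_rot :: "'d cmap \<Rightarrow> nat \<Rightarrow> 'd \<Rightarrow> 'd" where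
  "mono_rot M i = first_return (rot M) ({h \<in> half_edges M. dart_color M h = i} \<union> cilia M)"

definition face_perm :: "'d cmap \<Rightarrow> nat \<Rightarrow> 'd \<Rightarrow> 'd" where
  "face_perm M i = flip M \<circ> mono_rot M i"

text \<open>A broken face is the list of elements met from one cilium to the next one, both
  included; its first and last entries are its initial and final cilium.\<close>

definition broken_faces :: "'d cmap \<Rightarrow> nat \<Rightarrow> 'd list set" where
  "broken_faces M i =
     {map (\<lambda>k. (face_perm M i ^^ k) c) [0..<Suc n] | c n.
        c \<in> cilia M \<and> 0 < n \<and> (face_perm M i ^^ n) c \<in> cilia M \<and>
        (\<forall>k. 0 < k \<and> k < n \<longrightarrow> (face_perm M i ^^ k) c \<notin> cilia M)}"

definition nontrivial_faces :: "'d cmap \<Rightarrow> nat \<Rightarrow> 'd list set" where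
  "nontrivial_faces M i = {w \<in> broken_faces M i. set w \<inter> half_edges M \<noteq> {}}"

definition ciliated_vertices :: "'d cmap \<Rightarrow> 'd set set" where
  "ciliated_vertices M = {V \<in> vertices M. V \<inter> cilia M \<noteq> {}}"

datatype 'a bd_vertex = White 'a | Black 'a

text \<open>\<open>Face i w\<close> is drawn for the broken face \<open>w\<close> of color \<open>i\<close>, \<open>Added i V\<close> for a
  ciliated vertex \<open>V\<close> that color \<open>i\<close> has not reached.\<close>

datatype 'd bd_edge = Face nat "'d list" | Added nat "'d set"

definition boundary_edges :: "nat \<Rightarrow> 'd cmap \<Rightarrow> 'd bd_edge set" where
  "boundary_edges D M =
     {Face i w | i w. i \<in> {1..D} \<and> w \<in> nontrivial_faces M i} \<union>
     {Added i V | i V. i \<in> {1..D} \<and> V \<in> ciliated_vertices M \<and>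
        (\<forall>w\<in>nontrivial_faces M i. vertex_of M (hd w) \<noteq> V)}"

definition boundary_graph :: "nat \<Rightarrow> 'd cmap \<Rightarrow> ('d set bd_vertex, 'd bd_edge) cgraph" where
  "boundary_graph D M =
     \<lparr> white = White ` ciliated_vertices M,
       black = Black ` ciliated_vertices M,
       edges = boundary_edges D M,
       white_end = (\<lambda>e. case e of Face i w \<Rightarrow> White (vertex_of M (hd w)) | Added i V \<Rightarrow> White V),
       black_end = (\<lambda>e. case e of Face i w \<Rightarrow> Black (vertex_of M (last w)) | Added i V \<Rightarrow> Black V),
       edge_color = (\<lambda>e. case e of Face i w \<Rightarrow> i | Added i V \<Rightarrow> i) \<rparr>"

definition induced_pairing :: "'d cmap \<Rightarrow> 'd set bd_vertex set set" where
  "induced_pairing M = (\<lambda>V. {White V, Black V}) ` ciliated_vertices M"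

definition cilium_pair :: "'d cmap \<Rightarrow> 'd \<Rightarrow> 'd set bd_vertex set" where
  "cilium_pair M c = {White (vertex_of M c), Black (vertex_of M c)}"

end

theory Submission
  imports Defs "HOL-Library.Nat_Bijection"
begin

text \<open>Pair the white and black vertices of the bubble arbitrarily, \<open>v\<^sub>j\<close> with \<open>w\<^sub>j\<close>. The edges of color
  \<open>i\<close> then form a permutation \<open>\<tau> i\<close> of the indices. Take one ciliated vertex per index and, for each
  cycle of \<open>\<tau> i\<close>, one further vertex joined by edges of color \<open>i\<close> to the members of the cycle, in
  cyclic order. Turning around that vertex, the broken face of color \<open>i\<close> leaving the cilium \<open>j\<close>
  traverses two edges and ends at the cilium \<open>\<tau> i j\<close>. Conversely, in any map the broken faces of a
  given color induce a permutation of the cilia, namely the first return of the face permutation,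
  and this makes the boundary graph regular.\<close>

section \<open>First returns\<close>

text \<open>The exponent hidden inside \<open>first_return\<close>, named because a broken face
  needs its length as well as its final cilium.\<close>

definition return_time :: "('a \<Rightarrow> 'a) \<Rightarrow> 'a set \<Rightarrow> 'a \<Rightarrow> nat" where
  "return_time f S x = (LEAST n. 0 < n \<and> (f ^^ n) x \<in> S)"

lemma first_return_eq_funpow: "first_return f S x = (f ^^ return_time f S x) x"
  by (simp add: first_return_def return_time_def)

lemma return_time_eqI:
  assumes "0 < n" "(f ^^ n) x \<in> S" "\<And>k. 0 < k \<Longrightarrow> k < n \<Longrightarrow> (f ^^ k) x \<notin> S"
  shows "return_time f S x = n"
  unfolding return_time_def using assms by (intro Least_equality) (auto simp: not_less[symmetric])

lemma not_in_before_return_time: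
  "0 < k \<Longrightarrow> k < return_time f S x \<Longrightarrow> (f ^^ k) x \<notin> S"
  unfolding return_time_def by (auto dest: not_less_Least)

lemma funpow_mem:
  assumes "f ` A \<subseteq> A" "x \<in> A"
  shows "(f ^^ n) x \<in> A"
  using assms by (induction n) auto

lemma funpow_inj_on:
  assumes "inj_on f A" "f ` A \<subseteq> A"
  shows "inj_on (f ^^ n) A"
proof (induction n)
  case (Suc n)
  show ?case
  proof (rule inj_onI)
    fix x y assume xy: "x \<in> A" "y \<in> A" "(f ^^ Suc n) x = (f ^^ Suc n) y"
    then have "(f ^^ n) x = (f ^^ n) y"
      using inj_onD[OF assms(1)] funpow_mem[OF assms(2)] by simp
    then show "x = y" using Suc xy by (auto dest: inj_onD)
  qed
qed simp

text \<open>Pigeonhole on the forward orbit gives two equal iterates, and injectivity cancels the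
  shorter power. All hypotheses are relative to a finite set \<open>A\<close> stable under
  \<open>f\<close>, because \<open>mono_rot\<close> and \<open>face_perm\<close> are only controlled
  on the darts of their color and the cilia.\<close>

lemma ex_funpow_return:
  assumes "finite A" "inj_on f A" "f ` A \<subseteq> A" "x \<in> A"
  shows "\<exists>n>0. (f ^^ n) x = x"
proof -
  have "range (\<lambda>n. (f ^^ n) x) \<subseteq> A" using funpow_mem[OF assms(3,4)] by auto
  then have "finite (range (\<lambda>n. (f ^^ n) x))" using assms(1) finite_subset by blast
  then have "\<not> inj (\<lambda>n. (f ^^ n) x)" using finite_imageD infinite_UNIV_nat by blast
  then obtain a b where ab: "a < b" "(f ^^ a) x = (f ^^ b) x"
    unfolding inj_def by (metis linorder_neqE_nat)
  have "(f ^^ a) ((f ^^ (b - a)) x) = (f ^^ a) x"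
    using ab by (simp flip: comp_apply[of "f ^^ a"] funpow_add)
  then have "(f ^^ (b - a)) x = x"
    using funpow_inj_on[OF assms(2,3), of a] funpow_mem[OF assms(3,4)] assms(4)
    by (auto dest: inj_onD)
  then show ?thesis using ab(1) by (intro exI[of _ "b - a"]) auto
qed

context
  fixes A S :: "'a set" and f :: "'a \<Rightarrow> 'a"
  assumes fin: "finite A" and inj: "inj_on f A" and im: "f ` A \<subseteq> A" and sub: "S \<subseteq> A"
begin

lemma return_time_properties:
  assumes "x \<in> S"
  shows "0 < return_time f S x" "first_return f S x \<in> S"
proof -
  have "\<exists>n. 0 < n \<and> (f ^^ n) x \<in> S"
    using ex_funpow_return[OF fin inj im, of x] assms sub by (metis subsetD)
  from LeastI_ex[OF this] show "0 < return_time f S x" "first_return f S x \<in> S"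
    by (simp_all add: return_time_def first_return_def)
qed

text \<open>If the return times are \<open>m \<le> n\<close>, cancelling \<open>f ^^ m\<close> gives
  \<open>x = (f ^^ (n - m)) y\<close>, so the orbit of \<open>y\<close> is in \<open>S\<close> at
  time \<open>n - m\<close>. As \<open>m > 0\<close>, this would precede the first return of
  \<open>y\<close> unless \<open>n = m\<close>.\<close>

lemma first_return_inj_on: "inj_on (first_return f S) S"
proof -
  have *: "x = y"
    if xy: "x \<in> S" "y \<in> S" "first_return f S x = first_return f S y"
      and le: "return_time f S x \<le> return_time f S y" for x y
  proof -
    define m n where "m = return_time f S x" and "n = return_time f S y"
    have mn: "m \<le> n" "0 < m" using le return_time_properties(1) xy by (auto simp: m_def n_def)
    have "(f ^^ m) x = (f ^^ m) ((f ^^ (n - m)) y)"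
      using xy(3) mn by (simp add: first_return_eq_funpow flip: m_def n_def comp_apply[of "f ^^ m"] funpow_add)
    then have eq: "x = (f ^^ (n - m)) y"
      using funpow_inj_on[OF inj im, of m] funpow_mem[OF im] xy(1,2) sub
      by (auto dest!: inj_onD)
    then have "n - m = 0"
      using not_in_before_return_time[of "n - m" f S y] xy(1) mn by (fastforce simp: n_def)
    then show ?thesis using eq by simp
  qed
  show ?thesis
  proof (rule inj_onI)
    fix x y assume "x \<in> S" "y \<in> S" "first_return f S x = first_return f S y"
    then show "x = y" using *[of x y] *[of y x] by (metis nat_le_linear)
  qed
qed

lemma first_return_bij_betw: "bij_betw (first_return f S) S S"
  unfolding bij_betw_def
  using endo_inj_surj[OF finite_subset[OF sub fin] _ first_return_inj_on]
    first_return_inj_on return_time_properties(2) by blast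

end

section \<open>The boundary graph is regular\<close>

text \<open>The \<open>Suc\<close> keeps the final cilium in the list: the indices run from 0 to the
  return time inclusive.\<close>

definition broken_face :: "'d cmap \<Rightarrow> nat \<Rightarrow> 'd \<Rightarrow> 'd list" where
  "broken_face M i c =
     map (\<lambda>k. (face_perm M i ^^ k) c) [0..<Suc (return_time (face_perm M i) (cilia M) c)]"

text \<open>The permutation of the cilia from which the edges of color \<open>i\<close> in the
  boundary graph are read off.\<close>

definition next_cilium :: "'d cmap \<Rightarrow> nat \<Rightarrow> 'd \<Rightarrow> 'd" where
  "next_cilium M i = first_return (face_perm M i) (cilia M)"

lemma hd_broken_face [simp]: "hd (broken_face M i c) = c"
  by (simp add: broken_face_def hd_map hd_upt del: upt_Suc)

lemma last_broken_face [simp]: "last (broken_face M i c) = next_cilium M i c"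
  by (simp add: broken_face_def next_cilium_def first_return_eq_funpow last_map)

locale colored_map =
  fixes D :: nat and M :: "'d cmap"
  assumes map: "edge_colored_map D M"
begin

abbreviation "darts_of i \<equiv> {h \<in> half_edges M. dart_color M h = i} \<union> cilia M"

lemma finite_half_edges: "finite (half_edges M)"
  and finite_cilia: "finite (cilia M)"
  and half_edges_cilia_disjoint: "half_edges M \<inter> cilia M = {}"
  and rot_permutes: "rot M permutes (half_edges M \<union> cilia M)"
  and flip_permutes: "flip M permutes half_edges M"
  and dart_color_flip: "h \<in> half_edges M \<Longrightarrow> dart_color M (flip M h) = dart_color M h"
  and vertex_card: "V \<in> vertices M \<Longrightarrow> card (V \<inter> cilia M) \<le> 1"
  using map by (auto simp: edge_colored_map_def)

section \<open>Vertices as orbits, and their cilia\<close>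

lemma rot_permutation: "permutation (rot M)"
  using rot_permutes finite_half_edges finite_cilia by (auto simp: permutation_permutes)

lemma in_vertex_of_self: "x \<in> vertex_of M x"
  unfolding vertex_of_def using rot_permutation by (rule permutation_self_in_orbit)

lemma vertex_of_eqI: "x \<in> vertex_of M y \<Longrightarrow> vertex_of M x = vertex_of M y"
  unfolding vertex_of_def by (rule orbit_cyclic_eq3[OF cyclic_on_orbit'[OF rot_permutation]])

text \<open>A vertex carries at most one cilium. This lets the cilia index the ciliated vertices,
  and so both color classes of the boundary graph.\<close>

lemma vertex_of_inj_on_cilia: "inj_on (vertex_of M) (cilia M)"
proof (rule inj_onI)
  fix c d assume cd: "c \<in> cilia M" "d \<in> cilia M" "vertex_of M c = vertex_of M d"
  have "card (vertex_of M c \<inter> cilia M) \<le> 1"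
    using cd vertex_card by (auto simp: vertices_def)
  moreover have "c \<in> vertex_of M c \<inter> cilia M" "d \<in> vertex_of M c \<inter> cilia M"
    using cd in_vertex_of_self by auto
  ultimately show "c = d"
    using finite_cilia by (auto simp: card_le_Suc0_iff_eq)
qed

lemma ciliated_vertices_eq: "ciliated_vertices M = vertex_of M ` cilia M"
proof
  show "ciliated_vertices M \<subseteq> vertex_of M ` cilia M"
    unfolding ciliated_vertices_def vertices_def by (auto dest: vertex_of_eqI[symmetric])
  show "vertex_of M ` cilia M \<subseteq> ciliated_vertices M"
    unfolding ciliated_vertices_def vertices_def using in_vertex_of_self by blast
qed

lemma bij_betw_vertex_of: "bij_betw (vertex_of M) (cilia M) (ciliated_vertices M)"
  using vertex_of_inj_on_cilia by (simp add: bij_betw_def ciliated_vertices_eq)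

section \<open>The faces of one color\<close>

lemma mono_rot_bij_betw: "bij_betw (mono_rot M i) (darts_of i) (darts_of i)"
  unfolding mono_rot_def
  using rot_permutes finite_half_edges finite_cilia
  by (intro first_return_bij_betw[where A = "half_edges M \<union> cilia M"])
    (auto simp: permutes_inj_on permutes_image)

lemma flip_cilium: "c \<in> cilia M \<Longrightarrow> flip M c = c"
  using flip_permutes half_edges_cilia_disjoint by (auto simp: permutes_def)

lemma flip_in_half_edges_iff: "flip M h \<in> half_edges M \<longleftrightarrow> h \<in> half_edges M"
  using flip_permutes by (rule permutes_in_image)

text \<open>\<open>flip\<close> preserves colors and fixes cilia, so it restricts to the darts kept
  in the monochromatic submap; being injective on a finite set, it permutes them.\<close>

lemma face_perm_bij_betw: "bij_betw (face_perm M i) (darts_of i) (darts_of i)"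
proof -
  have "flip M ` darts_of i \<subseteq> darts_of i"
    by (auto simp: flip_cilium dart_color_flip flip_in_half_edges_iff)
  moreover have "inj_on (flip M) (darts_of i)"
    using flip_permutes by (rule permutes_inj_on)
  ultimately have "bij_betw (flip M) (darts_of i) (darts_of i)"
    unfolding bij_betw_def using finite_half_edges finite_cilia by (simp add: endo_inj_surj)
  then show ?thesis
    unfolding face_perm_def using mono_rot_bij_betw by (rule bij_betw_trans[rotated])
qed

lemma face_perm_return:
  assumes "c \<in> cilia M"
  shows "0 < return_time (face_perm M i) (cilia M) c" "next_cilium M i c \<in> cilia M"
  unfolding next_cilium_def
  using return_time_properties[where A = "darts_of i" and f = "face_perm M i" and S = "cilia M"]
    face_perm_bij_betw[of i] finite_half_edges finite_cilia assms
  by (auto simp: bij_betw_def)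

lemma next_cilium_bij_betw: "bij_betw (next_cilium M i) (cilia M) (cilia M)"
  unfolding next_cilium_def
  using face_perm_bij_betw[of i] finite_half_edges finite_cilia
  by (intro first_return_bij_betw[where A = "darts_of i"]) (auto simp: bij_betw_def)

text \<open>The conditions on \<open>n\<close> in \<open>broken_faces\<close> say precisely that
  \<open>n\<close> is the return time of \<open>c\<close>. Hence exactly one broken face of each
  color starts at each cilium.\<close>

lemma broken_faces_eq: "broken_faces M i = broken_face M i ` cilia M"
proof (intro equalityI subsetI)
  fix w assume "w \<in> broken_faces M i"
  then obtain c n where w: "w = map (\<lambda>k. (face_perm M i ^^ k) c) [0..<Suc n]" "c \<in> cilia M" "0 < n"
      "(face_perm M i ^^ n) c \<in> cilia M"
      "\<forall>k. 0 < k \<and> k < n \<longrightarrow> (face_perm M i ^^ k) c \<notin> cilia M"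
    unfolding broken_faces_def by blast
  then have "return_time (face_perm M i) (cilia M) c = n" by (intro return_time_eqI) auto
  then show "w \<in> broken_face M i ` cilia M" using w by (auto simp: broken_face_def)
next
  fix w assume "w \<in> broken_face M i ` cilia M"
  then obtain c where "c \<in> cilia M" "w = broken_face M i c" by blast
  then show "w \<in> broken_faces M i"
    unfolding broken_faces_def broken_face_def
    using face_perm_return[of c i] not_in_before_return_time[of _ "face_perm M i" "cilia M" c]
    by (auto simp: next_cilium_def first_return_eq_funpow simp del: upt_Suc)
qed

section \<open>The edges of the boundary graph\<close>

definition nontrivial_at :: "nat \<Rightarrow> 'd \<Rightarrow> bool" where
  "nontrivial_at i c \<longleftrightarrow> set (broken_face M i c) \<inter> half_edges M \<noteq> {}"

lemma nontrivial_faces_eq: "nontrivial_faces M i = broken_face M i ` {c \<in> cilia M. nontrivial_at i c}"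
  unfolding nontrivial_faces_def broken_faces_eq nontrivial_at_def by auto

text \<open>A trivial face stays at its vertex, and a vertex has at most one cilium. Hence the
  extra edge at \<open>v\<close> also fills the missing color at \<open>\<bar>v\<close>.\<close>

lemma next_cilium_trivial:
  assumes "c \<in> cilia M" "\<not> nontrivial_at i c"
  shows "next_cilium M i c = c"
proof -
  let ?\<phi> = "face_perm M i"
  \<comment> \<open>Index 1 occurs in the list because the return time is positive.\<close>
  have "?\<phi> c \<in> set (broken_face M i c)"
    using face_perm_return(1)[OF assms(1), of i]
    by (auto simp: broken_face_def image_iff simp del: upt_Suc intro!: bexI[of _ 1])
  then have "?\<phi> c \<notin> half_edges M" using assms(2) by (auto simp: nontrivial_at_def)
  then have "mono_rot M i c \<notin> half_edges M"
    by (simp add: face_perm_def flip_in_half_edges_iff)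
  moreover have "mono_rot M i c \<in> darts_of i"
    using mono_rot_bij_betw assms(1) by (auto dest: bij_betwE)
  ultimately have cil: "mono_rot M i c \<in> cilia M" by auto
  \<comment> \<open>\<open>mono_rot\<close> applies an iterate of \<open>rot\<close>, so it does not
    leave the vertex, whose only cilium is \<open>c\<close>.\<close>
  have "mono_rot M i c \<in> vertex_of M c"
    unfolding vertex_of_def mono_rot_def first_return_def
    by (intro funpow_in_orbit permutation_self_in_orbit rot_permutation)
  then have "mono_rot M i c = c"
    using inj_onD[OF vertex_of_inj_on_cilia vertex_of_eqI cil assms(1)] by blast
  then have "?\<phi> c = c" by (simp add: face_perm_def flip_cilium assms(1))
  then have "return_time ?\<phi> (cilia M) c = 1"
    using assms(1) by (intro return_time_eqI) auto
  then show ?thesis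
    using \<open>?\<phi> c = c\<close> by (simp add: next_cilium_def first_return_eq_funpow)
qed

text \<open>The one edge of color \<open>i\<close> leaving the white vertex of \<open>c\<close>,
  whether drawn for a face or added. It parametrizes all boundary edges by pairs of a color and a
  cilium.\<close>

definition edge_at :: "nat \<Rightarrow> 'd \<Rightarrow> 'd bd_edge" where
  "edge_at i c = (if nontrivial_at i c then Face i (broken_face M i c) else Added i (vertex_of M c))"

lemma boundary_edges_eq: "boundary_edges D M = (\<lambda>(i, c). edge_at i c) ` ({1..D} \<times> cilia M)"
proof (intro equalityI subsetI)
  fix e assume "e \<in> boundary_edges D M"
  then show "e \<in> (\<lambda>(i, c). edge_at i c) ` ({1..D} \<times> cilia M)"
    unfolding boundary_edges_def nontrivial_faces_eq ciliated_vertices_eq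
    by (force simp: edge_at_def image_iff)
next
  fix e assume "e \<in> (\<lambda>(i, c). edge_at i c) ` ({1..D} \<times> cilia M)"
  then obtain i c where ic: "i \<in> {1..D}" "c \<in> cilia M" "e = edge_at i c" by auto
  show "e \<in> boundary_edges D M"
  proof (cases "nontrivial_at i c")
    case False
    \<comment> \<open>An added edge requires that no non-trivial face starts at the vertex. Its only
      cilium is \<open>c\<close>, whose face is trivial.\<close>
    have "vertex_of M c' \<noteq> vertex_of M c" if "c' \<in> cilia M" "nontrivial_at i c'" for c'
      using that ic False inj_onD[OF vertex_of_inj_on_cilia, of c' c] by auto
    then show ?thesis
      using False ic
      by (auto simp: boundary_edges_def edge_at_def nontrivial_faces_eq ciliated_vertices_eq)
  qed (use ic in \<open>auto simp: boundary_edges_def edge_at_def nontrivial_faces_eq\<close>)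
qed

text \<open>For an added edge \<open>next_cilium\<close> fixes \<open>c\<close>, so both kinds of
  edge obey the same formula for the black end.\<close>

lemma boundary_edge_at:
  assumes "c \<in> cilia M"
  shows "white_end (boundary_graph D M) (edge_at i c) = White (vertex_of M c)"
    "black_end (boundary_graph D M) (edge_at i c) = Black (vertex_of M (next_cilium M i c))"
    "edge_color (boundary_graph D M) (edge_at i c) = i"
  using next_cilium_trivial[OF assms, of i] by (auto simp: boundary_graph_def edge_at_def)

lemma boundary_graph_simps:
  "white (boundary_graph D M) = White ` ciliated_vertices M"
  "black (boundary_graph D M) = Black ` ciliated_vertices M"
  "edges (boundary_graph D M) = boundary_edges D M"
  by (simp_all add: boundary_graph_def)

lemma colored_graph_boundary: "colored_graph D (boundary_graph D M)"
  unfolding colored_graph_def boundary_graph_simps boundary_edges_eq ciliated_vertices_eq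
  using finite_cilia face_perm_return(2) by (auto simp: boundary_edge_at)

text \<open>In color \<open>i\<close>, the white vertex of \<open>c\<close> meets only
  \<open>edge_at i c\<close>, and the black vertex of \<open>b\<close> meets only the edge at the
  preimage of \<open>b\<close> under the permutation \<open>next_cilium M i\<close>.\<close>

lemma color_regular_boundary: "color_regular D (boundary_graph D M)"
  unfolding color_regular_def
proof (intro ballI)
  let ?G = "boundary_graph D M"
  fix v i assume v: "v \<in> white ?G \<union> black ?G" and i: "i \<in> {1..D}"
  have inj: "vertex_of M c = vertex_of M d \<longleftrightarrow> c = d" if "c \<in> cilia M" "d \<in> cilia M" for c d
    using that by (simp add: inj_on_eq_iff[OF vertex_of_inj_on_cilia])
  have inj': "next_cilium M i c = next_cilium M i d \<longleftrightarrow> c = d" if "c \<in> cilia M" "d \<in> cilia M" for c d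
    using that by (simp add: inj_on_eq_iff[OF bij_betw_imp_inj_on[OF next_cilium_bij_betw]])
  have "\<exists>c\<in>cilia M. \<forall>d\<in>cilia M.
      (white_end ?G (edge_at i d) = v \<or> black_end ?G (edge_at i d) = v) = (d = c)"
  proof (cases "v \<in> white ?G")
    case True
    then obtain c where "c \<in> cilia M" "v = White (vertex_of M c)"
      by (auto simp: boundary_graph_simps ciliated_vertices_eq)
    then show ?thesis by (intro bexI[of _ c]) (auto simp: boundary_edge_at inj)
  next
    case False
    then obtain b where b: "b \<in> cilia M" "v = Black (vertex_of M b)"
      using v by (auto simp: boundary_graph_simps ciliated_vertices_eq)
    then obtain c where "c \<in> cilia M" "b = next_cilium M i c"
      using bij_betw_imp_surj_on[OF next_cilium_bij_betw[of i]] by (metis imageE)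
    then show ?thesis using b
      by (intro bexI[of _ c]) (auto simp: boundary_edge_at inj inj' face_perm_return)
  qed
  then obtain c where c: "c \<in> cilia M"
      "\<And>d. d \<in> cilia M \<Longrightarrow>
        (white_end ?G (edge_at i d) = v \<or> black_end ?G (edge_at i d) = v) = (d = c)" by metis
  show "\<exists>!e. e \<in> edges ?G \<and> edge_color ?G e = i \<and> (white_end ?G e = v \<or> black_end ?G e = v)"
  proof (rule ex1I[of _ "edge_at i c"])
    show "edge_at i c \<in> edges ?G \<and> edge_color ?G (edge_at i c) = i \<and>
        (white_end ?G (edge_at i c) = v \<or> black_end ?G (edge_at i c) = v)"
      using c i by (auto simp: boundary_graph_simps boundary_edges_eq boundary_edge_at)
  next
    fix e assume e: "e \<in> edges ?G \<and> edge_color ?G e = i \<and> (white_end ?G e = v \<or> black_end ?G e = v)"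
    then obtain j d where d: "d \<in> cilia M" "e = edge_at j d"
      by (auto simp: boundary_graph_simps boundary_edges_eq)
    then show "e = edge_at i c" using e c(2)[of d] by (auto simp: boundary_edge_at)
  qed
qed

lemma card_ciliated_vertices: "card (ciliated_vertices M) = card (cilia M)"
  using bij_betw_same_card[OF bij_betw_vertex_of] by simp

lemma boundary_graph_regular: "boundary_graph D M \<in> regular_graphs D (card (cilia M))"
  unfolding regular_graphs_def
  using colored_graph_boundary color_regular_boundary card_ciliated_vertices
  by (simp add: boundary_graph_simps card_image inj_on_def)

lemma is_pairing_induced: "is_pairing (boundary_graph D M) (induced_pairing M)"
  unfolding is_pairing_def induced_pairing_def boundary_graph_simps
  by (auto intro!: partition_onI simp: disjnt_def)

lemma cilium_pair_bij_betw: "bij_betw (cilium_pair M) (cilia M) (induced_pairing M)"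
  using vertex_of_inj_on_cilia
  by (auto simp: bij_betw_def inj_on_def cilium_pair_def induced_pairing_def ciliated_vertices_eq
      doubleton_eq_iff)

end

section \<open>Star maps\<close>

text \<open>The dart \<open>prod_encode (j, k)\<close> is the cilium of the \<open>j\<close>-th ciliated vertex if \<open>k = 0\<close>, the
  half-edge of color \<open>k\<close> at that vertex if \<open>1 \<le> k \<le> D\<close>, and the opposite half of the edge of
  color \<open>k - D\<close> if \<open>D < k \<le> 2 * D\<close>. The vertices without cilium are the cycles of \<open>\<tau> i\<close>.\<close>

definition star_map :: "nat \<Rightarrow> nat \<Rightarrow> (nat \<Rightarrow> nat \<Rightarrow> nat) \<Rightarrow> nat cmap" where
  "star_map D p \<tau> =
     \<lparr> half_edges = prod_encode ` ({..<p} \<times> {1..2 * D}),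
       cilia = prod_encode ` ({..<p} \<times> {0}),
       rot = (\<lambda>x. case prod_decode x of (j, k) \<Rightarrow>
          if p \<le> j \<or> 2 * D < k then x
          else if k \<le> D then prod_encode (j, Suc k mod Suc D)
          else prod_encode (\<tau> (k - D) j, k)),
       flip = (\<lambda>x. case prod_decode x of (j, k) \<Rightarrow>
          if p \<le> j \<or> k = 0 \<or> 2 * D < k then x
          else if k \<le> D then prod_encode (j, k + D)
          else prod_encode (j, k - D)),
       dart_color = (\<lambda>x. let k = snd (prod_decode x) in if k \<le> D then k else k - D) \<rparr>"

lemma star_map_sets:
  "half_edges (star_map D p \<tau>) = prod_encode ` ({..<p} \<times> {1..2 * D})"
  "cilia (star_map D p \<tau>) = prod_encode ` ({..<p} \<times> {0})"
  by (simp_all add: star_map_def)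

lemma star_map_mem [simp]:
  "prod_encode (j, k) \<in> half_edges (star_map D p \<tau>) \<longleftrightarrow> j < p \<and> 1 \<le> k \<and> k \<le> 2 * D"
  "prod_encode (j, k) \<in> cilia (star_map D p \<tau>) \<longleftrightarrow> j < p \<and> k = 0"
  by (auto simp: star_map_sets inj_image_mem_iff[OF inj_prod_encode])

lemma star_map_apply [simp]:
  "rot (star_map D p \<tau>) (prod_encode (j, k)) =
     (if p \<le> j \<or> 2 * D < k then prod_encode (j, k)
      else if k \<le> D then prod_encode (j, Suc k mod Suc D)
      else prod_encode (\<tau> (k - D) j, k))"
  "flip (star_map D p \<tau>) (prod_encode (j, k)) =
     (if p \<le> j \<or> k = 0 \<or> 2 * D < k then prod_encode (j, k)
      else if k \<le> D then prod_encode (j, k + D)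
      else prod_encode (j, k - D))"
  "dart_color (star_map D p \<tau>) (prod_encode (j, k)) = (if k \<le> D then k else k - D)"
  by (simp_all add: star_map_def)

lemma prod_encode_cases: obtains j k where "x = prod_encode (j, k)"
  by (metis prod_decode_inverse surj_pair)

text \<open>What remains of a bubble once its paired vertices are merged into indices: one
  permutation per color, and connectedness in the form that these permutations act
  transitively.\<close>

locale star =
  fixes D p :: nat and \<tau> :: "nat \<Rightarrow> nat \<Rightarrow> nat"
  assumes \<tau>_bij: "i \<in> {1..D} \<Longrightarrow> bij_betw (\<tau> i) {..<p} {..<p}"
    and \<tau>_transitive: "j < p \<Longrightarrow> k < p \<Longrightarrow>
      (j, k) \<in> (\<Union>i\<in>{1..D}. \<Union>l\<in>{..<p}. {(l, \<tau> i l), (\<tau> i l, l)})\<^sup>*"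
begin

abbreviation "M \<equiv> star_map D p \<tau>"

lemma \<tau>_less: "i \<in> {1..D} \<Longrightarrow> j < p \<Longrightarrow> \<tau> i j < p"
  using \<tau>_bij[of i] by (auto dest: bij_betwE)

lemma \<tau>_eq_iff: "i \<in> {1..D} \<Longrightarrow> j < p \<Longrightarrow> k < p \<Longrightarrow> \<tau> i j = \<tau> i k \<longleftrightarrow> j = k"
  by (simp add: inj_on_eq_iff[OF bij_betw_imp_inj_on[OF \<tau>_bij]])

lemma \<tau>_less': "D < k \<Longrightarrow> k \<le> 2 * D \<Longrightarrow> j < p \<Longrightarrow> \<tau> (k - D) j < p"
  by (rule \<tau>_less) auto

lemma \<tau>_eq_iff': "D < l \<Longrightarrow> l \<le> 2 * D \<Longrightarrow> j < p \<Longrightarrow> k < p \<Longrightarrow> \<tau> (l - D) j = \<tau> (l - D) k \<longleftrightarrow> j = k"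
  by (rule \<tau>_eq_iff) auto

lemma darts_eq: "half_edges M \<union> cilia M = prod_encode ` ({..<p} \<times> {..2 * D})"
proof -
  have "x \<in> half_edges M \<union> cilia M \<longleftrightarrow> x \<in> prod_encode ` ({..<p} \<times> {..2 * D})" for x
    by (cases x rule: prod_encode_cases) (auto simp: inj_image_mem_iff[OF inj_prod_encode])
  then show ?thesis by blast
qed

lemma Suc_mod_Suc_eq_iff:
  "k \<le> D \<Longrightarrow> l \<le> D \<Longrightarrow> Suc k mod Suc D = Suc l mod Suc D \<longleftrightarrow> k = l"
  by (auto simp: mod_Suc)

lemma Suc_mod_Suc_le: "Suc k mod Suc D \<le> D"
  using mod_less_divisor[of "Suc D" "Suc k"] by linarith

text \<open>Darts with \<open>k \<le> D\<close> are shifted cyclically within their index: cilium,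
  colors 1 to \<open>D\<close>, cilium. Darts with \<open>k > D\<close> keep \<open>k\<close> while
  the bijection \<open>\<tau> (k - D)\<close> moves their index. The two ranges never mix, so
  injectivity can be checked on each.\<close>

lemma rot_permutes: "rot M permutes (half_edges M \<union> cilia M)"
  unfolding darts_eq
proof (rule inj_imp_permutes)
  show "inj_on (rot M) (prod_encode ` ({..<p} \<times> {..2 * D}))"
    by (auto intro!: inj_onI simp: Suc_mod_Suc_le[THEN leD] Suc_mod_Suc_eq_iff \<tau>_eq_iff' not_le split: if_splits)
  show "rot M x \<in> prod_encode ` ({..<p} \<times> {..2 * D})"
    if "x \<in> prod_encode ` ({..<p} \<times> {..2 * D})" for x
    using that order_trans[OF Suc_mod_Suc_le, of "2 * D"]
    by (cases x rule: prod_encode_cases) (auto simp: \<tau>_less' inj_image_mem_iff[OF inj_prod_encode] not_le)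
  show "rot M x = x" if "x \<notin> prod_encode ` ({..<p} \<times> {..2 * D})" for x
    using that by (cases x rule: prod_encode_cases) (auto simp: inj_image_mem_iff[OF inj_prod_encode])
qed simp

lemma flip_permutes: "flip M permutes half_edges M"
proof (rule inj_imp_permutes)
  show "inj_on (flip M) (half_edges M)"
    unfolding star_map_sets by (fastforce intro!: inj_onI split: if_splits)
  show "flip M x \<in> half_edges M" if "x \<in> half_edges M" for x
    using that by (cases x rule: prod_encode_cases) auto
  show "flip M x = x" if "x \<notin> half_edges M" for x
    using that by (cases x rule: prod_encode_cases) auto
qed (simp add: star_map_sets)

lemma rot_permutation: "permutation (rot M)"
  unfolding permutation_permutes
  using rot_permutes by (intro exI[of _ "half_edges M \<union> cilia M"]) (simp add: star_map_sets)

section \<open>Vertices and connectedness of the star map\<close>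

lemma vertex_of_rot: "vertex_of M (rot M x) = vertex_of M x"
  unfolding vertex_of_def using rot_permutation by (rule permutation_orbit_step)

lemma rot_funpow: "j < p \<Longrightarrow> k + n \<le> D \<Longrightarrow>
    (rot M ^^ n) (prod_encode (j, k)) = prod_encode (j, k + n)"
  by (induction n) auto

lemma vertex_of_near: "j < p \<Longrightarrow> k \<le> D \<Longrightarrow> vertex_of M (prod_encode (j, k)) = vertex_of M (prod_encode (j, 0))"
proof (induction k)
  case (Suc k)
  then show ?case using vertex_of_rot[of "prod_encode (j, k)"] by simp
qed simp

lemma vertex_card:
  assumes "V \<in> vertices M"
  shows "card (V \<inter> cilia M) \<le> 1"
proof -
  obtain j k where V: "V = vertex_of M (prod_encode (j, k))" "j < p" "k \<le> 2 * D"
    using assms unfolding vertices_def darts_eq by auto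
  show ?thesis
  proof (cases "k \<le> D")
    case True
    \<comment> \<open>The orbit stays within index \<open>j\<close> and \<open>k \<le> D\<close>,
      where \<open>k = 0\<close> is the only cilium.\<close>
    have "y \<in> prod_encode ` ({j} \<times> {..D})" if "y \<in> V" for y
      using that V(2) True unfolding V(1) vertex_of_def
      by induction (auto simp: Suc_mod_Suc_le)
    then have "V \<inter> cilia M \<subseteq> {prod_encode (j, 0)}" by fastforce
    then show ?thesis using card_mono[of "{prod_encode (j, 0)}"] by fastforce
  next
    case False
    \<comment> \<open>The orbit of a dart at a centre stays in the range \<open>k > D\<close>, which
      has no cilia.\<close>
    have "y \<in> prod_encode ` ({..<p} \<times> {D<..2 * D})" if "y \<in> V" for y
      using that V(2,3) False unfolding V(1) vertex_of_def
      by induction (auto simp: \<tau>_less' inj_image_mem_iff[OF inj_prod_encode] not_le)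
    then have "V \<inter> cilia M = {}" by fastforce
    then show ?thesis by simp
  qed
qed

text \<open>Every vertex is ciliated or adjacent to a ciliated one. The ciliated vertices
  \<open>j\<close> and \<open>\<tau> i j\<close> are both adjacent to the centre of their common
  cycle, and transitivity chains such steps.\<close>

lemma connected: "connected_cmap M"
proof -
  let ?R = "(\<lambda>h. (vertex_of M h, vertex_of M (flip M h))) ` half_edges M"
  let ?v = "\<lambda>j. vertex_of M (prod_encode (j, 0))"
  have out: "(?v j, vertex_of M (prod_encode (j, i + D))) \<in> ?R"
    and into: "(vertex_of M (prod_encode (j, i + D)), ?v j) \<in> ?R"
    if "i \<in> {1..D}" "j < p" for i j
    using that vertex_of_near[of j i]
    by (auto simp: image_iff intro: bexI[of _ "prod_encode (j, i)"] bexI[of _ "prod_encode (j, i + D)"])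
  \<comment> \<open>\<open>rot\<close> itself takes one dart to the other.\<close>
  have centre: "vertex_of M (prod_encode (\<tau> i j, i + D)) = vertex_of M (prod_encode (j, i + D))"
    if "i \<in> {1..D}" "j < p" for i j
    using that vertex_of_rot[of "prod_encode (j, i + D)"] by auto
  have star_step: "(?v j, ?v (\<tau> i j)) \<in> ?R\<^sup>*" "(?v (\<tau> i j), ?v j) \<in> ?R\<^sup>*"
    if "i \<in> {1..D}" "j < p" for i j
    using out[OF that] into[OF that] out[OF that(1) \<tau>_less[OF that]] into[OF that(1) \<tau>_less[OF that]]
    by (auto simp: centre[OF that] intro: rtrancl_trans)
  have path: "(?v j, ?v k) \<in> ?R\<^sup>*" if "j < p" "k < p" for j k
    using \<tau>_transitive[OF that]
  proof (induction rule: rtrancl_induct)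
    case (step k l)
    then obtain i m where "i \<in> {1..D}" "m < p" "(k, l) = (m, \<tau> i m) \<or> (k, l) = (\<tau> i m, m)"
      by blast
    then have "(?v k, ?v l) \<in> ?R\<^sup>*" using star_step by blast
    with step.IH show ?case by (rule rtrancl_trans)
  qed simp
  have cilium: "\<exists>j<p. (V, ?v j) \<in> ?R\<^sup>* \<and> (?v j, V) \<in> ?R\<^sup>*" if V: "V \<in> vertices M" for V
  proof -
    obtain j k where V: "V = vertex_of M (prod_encode (j, k))" "j < p" "k \<le> 2 * D"
      using V unfolding vertices_def darts_eq by auto
    show ?thesis
    proof (cases "k \<le> D")
      case True
      then have "V = ?v j" using V(1,2) vertex_of_near by metis
      then show ?thesis using V(2) by blast
    next
      case False
      then have "k - D \<in> {1..D}" "k - D + D = k" using V(3) by auto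
      then have "(?v j, V) \<in> ?R" "(V, ?v j) \<in> ?R"
        using out[of "k - D" j] into[of "k - D" j] V(1,2) by metis+
      then show ?thesis using V(2) by blast
    qed
  qed
  show ?thesis
    unfolding connected_cmap_def using cilium path by (meson rtrancl_trans)
qed

lemma edge_colored_map: "edge_colored_map D M"
  unfolding edge_colored_map_def
proof (intro conjI)
  show "half_edges M \<inter> cilia M = {}" by (auto simp: star_map_sets)
  show "\<forall>h\<in>half_edges M. flip M h \<noteq> h \<and> flip M (flip M h) = h" by (auto simp: star_map_sets)
  show "\<forall>h\<in>half_edges M. dart_color M h \<in> {1..D} \<and> dart_color M (flip M h) = dart_color M h"
    by (auto simp: star_map_sets)
  show "\<forall>V\<in>vertices M. card (V \<inter> cilia M) \<le> 1" using vertex_card by blast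
qed (simp_all add: rot_permutes flip_permutes connected, simp_all add: star_map_sets)

lemma card_cilia: "card (cilia M) = p"
  by (simp add: star_map_sets card_image inj_prod_encode card_cartesian_product)

section \<open>Broken faces of the star map\<close>

lemma mono_rot_star:
  assumes "i \<in> {1..D}" "j < p"
  shows "mono_rot M i (prod_encode (j, 0)) = prod_encode (j, i)"
    "mono_rot M i (prod_encode (j, i)) = prod_encode (j, 0)"
    "mono_rot M i (prod_encode (j, i + D)) = prod_encode (\<tau> i j, i + D)"
proof -
  let ?S = "{h \<in> half_edges M. dart_color M h = i} \<union> cilia M"
  \<comment> \<open>From the cilium, the colors 1 to \<open>i - 1\<close> are skipped.\<close>
  have "return_time (rot M) ?S (prod_encode (j, 0)) = i"
    using assms by (intro return_time_eqI) (auto simp: rot_funpow)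
  then show "mono_rot M i (prod_encode (j, 0)) = prod_encode (j, i)"
    using assms by (simp add: mono_rot_def first_return_eq_funpow rot_funpow)
  \<comment> \<open>From color \<open>i\<close>, \<open>D - i\<close> steps reach color
    \<open>D\<close> and one more wraps round to the cilium.\<close>
  have last: "(rot M ^^ Suc (D - i)) (prod_encode (j, i)) = prod_encode (j, 0)"
    using assms by (simp add: rot_funpow)
  then have "return_time (rot M) ?S (prod_encode (j, i)) = Suc (D - i)"
    using assms by (intro return_time_eqI) (auto simp: rot_funpow simp del: funpow.simps)
  then show "mono_rot M i (prod_encode (j, i)) = prod_encode (j, 0)"
    using last by (simp add: mono_rot_def first_return_eq_funpow)
  \<comment> \<open>All half-edges at this centre have color \<open>i\<close>, so nothing is skipped
    there.\<close>
  have "return_time (rot M) ?S (prod_encode (j, i + D)) = 1"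
    using assms by (intro return_time_eqI) (auto simp: \<tau>_less)
  then show "mono_rot M i (prod_encode (j, i + D)) = prod_encode (\<tau> i j, i + D)"
    using assms by (simp add: mono_rot_def first_return_eq_funpow)
qed

lemma next_cilium_star:
  assumes "i \<in> {1..D}" "j < p"
  shows "next_cilium M i (prod_encode (j, 0)) = prod_encode (\<tau> i j, 0)"
proof -
  let ?\<phi> = "face_perm M i" and ?c = "prod_encode (j, 0)"
  \<comment> \<open>The face crosses the edge at \<open>j\<close> to the centre, turns there to the
    next member of the cycle, and crosses that edge to the vertex \<open>\<tau> i j\<close>, where
    the next dart is the cilium, fixed by \<open>flip\<close>.\<close>
  have \<phi>: "?\<phi> ?c = prod_encode (j, i + D)"
    "?\<phi> (prod_encode (j, i + D)) = prod_encode (\<tau> i j, i)"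
    "?\<phi> (prod_encode (\<tau> i j, i)) = prod_encode (\<tau> i j, 0)"
    using assms by (auto simp add: face_perm_def mono_rot_star \<tau>_less not_le)
  have pow: "(?\<phi> ^^ 1) ?c = prod_encode (j, i + D)" "(?\<phi> ^^ 2) ?c = prod_encode (\<tau> i j, i)"
    "(?\<phi> ^^ 3) ?c = prod_encode (\<tau> i j, 0)"
    by (simp_all add: \<phi> eval_nat_numeral)
  have "return_time ?\<phi> (cilia M) ?c = 3"
  proof (rule return_time_eqI)
    fix k :: nat assume "0 < k" "k < 3"
    then have "k = 1 \<or> k = 2" by linarith
    then show "(?\<phi> ^^ k) ?c \<notin> cilia M" using assms pow(1,2) by (metis star_map_mem(2) add_is_0 atLeastAtMost_iff not_one_le_zero)
  qed (use assms pow(3) in \<open>auto simp: \<tau>_less\<close>)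
  then show ?thesis using pow(3) by (simp add: next_cilium_def first_return_eq_funpow)
qed

end

section \<open>From bubbles to maps\<close>

lemma colored_graph_unique_edge:
  assumes "colored_graph D G" "color_regular D G" "e \<in> edges G" "e' \<in> edges G"
    "edge_color G e = edge_color G e'"
    "white_end G e = white_end G e' \<or> black_end G e = black_end G e'"
  shows "e = e'"
proof -
  obtain v where v: "v \<in> white G \<union> black G" "white_end G e = v \<or> black_end G e = v"
      "white_end G e' = v \<or> black_end G e' = v"
    using assms unfolding colored_graph_def by (metis UnI1 UnI2)
  have "\<exists>!x. x \<in> edges G \<and> edge_color G x = edge_color G e \<and> (white_end G x = v \<or> black_end G x = v)"
    using assms v unfolding color_regular_def colored_graph_def by simp
  then show ?thesis using v assms by metis
qed

lemma colored_graph_edge_at_white: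
  assumes "colored_graph D G" "color_regular D G" "v \<in> white G" "i \<in> {1..D}"
  obtains e where "e \<in> edges G" "edge_color G e = i" "white_end G e = v"
proof -
  obtain e where "e \<in> edges G" "edge_color G e = i" "white_end G e = v \<or> black_end G e = v"
    using assms unfolding color_regular_def by (metis UnI1)
  moreover have "black_end G e \<noteq> v" if "e \<in> edges G" for e
    using assms that unfolding colored_graph_def by blast
  ultimately show ?thesis using that by blast
qed

text \<open>It suffices to find an image for each edge, since a color and a white end determine an
  edge on either side. This makes the edge map injective; for surjectivity, pull back the white end
  of an edge of \<open>H\<close> and take the edge of its color there in \<open>G\<close>.\<close>

lemma cgraph_isoI:
  assumes G: "colored_graph D G" "color_regular D G"
    and H: "colored_graph D H" "color_regular D H"
    and f: "bij_betw f (white G) (white H)" "bij_betw f (black G) (black H)"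
    and edge: "\<And>e. e \<in> edges G \<Longrightarrow> \<exists>e'\<in>edges H. white_end H e' = f (white_end G e) \<and>
      black_end H e' = f (black_end G e) \<and> edge_color H e' = edge_color G e"
  shows "G \<simeq>\<^sub>c H"
proof -
  obtain g where g: "\<And>e. e \<in> edges G \<Longrightarrow> g e \<in> edges H \<and> white_end H (g e) = f (white_end G e) \<and>
      black_end H (g e) = f (black_end G e) \<and> edge_color H (g e) = edge_color G e"
    using edge by metis
  have "inj_on g (edges G)"
  proof (rule inj_onI)
    fix e e' assume e: "e \<in> edges G" "e' \<in> edges G" "g e = g e'"
    then have "f (white_end G e) = f (white_end G e')" "edge_color G e = edge_color G e'"
      using g by metis+
    moreover have "white_end G e \<in> white G" "white_end G e' \<in> white G"
      using G e by (auto simp: colored_graph_def)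
    ultimately show "e = e'"
      using colored_graph_unique_edge[OF G e(1,2)] bij_betw_imp_inj_on[OF f(1)] by (metis inj_onD)
  qed
  moreover have "edges H \<subseteq> g ` edges G"
  proof
    fix e' assume e': "e' \<in> edges H"
    then have "white_end H e' \<in> white H" and i: "edge_color H e' \<in> {1..D}"
      using H by (auto simp: colored_graph_def)
    then obtain v where v: "v \<in> white G" "white_end H e' = f v"
      using bij_betw_imp_surj_on[OF f(1)] by blast
    obtain e where e: "e \<in> edges G" "edge_color G e = edge_color H e'" "white_end G e = v"
      using colored_graph_edge_at_white[OF G v(1) i] by blast
    then have "g e = e'"
      using g[of e] v e' by (intro colored_graph_unique_edge[OF H]) auto
    then show "e' \<in> g ` edges G" using e by blast
  qed
  ultimately have "bij_betw g (edges G) (edges H)" using g by (auto simp: bij_betw_def)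
  then show ?thesis unfolding cgraph_iso_def using f g by blast
qed

theorem bubble_is_boundary:
  fixes B :: "('v, 'e) cgraph"
  assumes "B \<in> bubbles D p"
  shows "\<exists>M \<in> (edge_colored_maps D p :: nat cmap set). boundary_graph D M \<simeq>\<^sub>c B"
proof -
  have B: "colored_graph D B" "color_regular D B" "card (black B) = p" "card (white B) = p"
    "connected_cgraph B"
    using assms by (auto simp: bubbles_def regular_graphs_def)
  have fin: "finite (white B)" "finite (black B)" "white B \<inter> black B = {}"
    using B(1) by (auto simp: colored_graph_def)
  have ends: "white_end B e \<in> white B" "black_end B e \<in> black B" "edge_color B e \<in> {1..D}"
    if "e \<in> edges B" for e using B(1) that by (auto simp: colored_graph_def)
  \<comment> \<open>Two arbitrary numberings; the pairing matches \<open>a j\<close> with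
    \<open>b j\<close>.\<close>
  obtain a where a: "bij_betw a {..<p} (white B)"
    using ex_bij_betw_nat_finite[OF fin(1)] B(4) by (auto simp: atLeast0LessThan)
  obtain b where b: "bij_betw b {..<p} (black B)"
    using ex_bij_betw_nat_finite[OF fin(2)] B(3) by (auto simp: atLeast0LessThan)
  have "\<forall>i\<in>{1..D}. \<forall>j<p. \<exists>k<p. \<exists>e\<in>edges B. edge_color B e = i \<and> white_end B e = a j \<and> black_end B e = b k"
  proof (intro ballI allI impI)
    fix i j assume i: "i \<in> {1..D}" and "j < p"
    then have "a j \<in> white B" using a by (auto dest: bij_betwE)
    then obtain e where e: "e \<in> edges B" "edge_color B e = i" "white_end B e = a j"
      using colored_graph_edge_at_white[OF B(1,2) _ i] by metis
    moreover obtain k where "k < p" "black_end B e = b k"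
      using ends(2)[OF e(1)] bij_betw_imp_surj_on[OF b] by blast
    ultimately show "\<exists>k<p. \<exists>e\<in>edges B. edge_color B e = i \<and> white_end B e = a j \<and> black_end B e = b k"
      by blast
  qed
  \<comment> \<open>\<open>\<tau> i\<close> sends the number of a white vertex to that of its
    neighbor of color \<open>i\<close>.\<close>
  then obtain \<tau> where \<tau>: "\<And>i j. i \<in> {1..D} \<Longrightarrow> j < p \<Longrightarrow> \<tau> i j < p \<and>
      (\<exists>e\<in>edges B. edge_color B e = i \<and> white_end B e = a j \<and> black_end B e = b (\<tau> i j))"
    by metis
  have a_eq: "a j = a k \<longleftrightarrow> j = k" if "j < p" "k < p" for j k
    using that by (simp add: inj_on_eq_iff[OF bij_betw_imp_inj_on[OF a]])
  \<comment> \<open>By uniqueness this holds for every edge at \<open>a j\<close>, not just for the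
    chosen one.\<close>
  have \<tau>_edge: "black_end B e = b (\<tau> (edge_color B e) j)"
    if "e \<in> edges B" "white_end B e = a j" "j < p" for e j
    using \<tau>[OF ends(3)[OF that(1)] that(3)] colored_graph_unique_edge[OF B(1,2) that(1)] that(2)
    by metis
  have inj: "inj_on (\<tau> i) {..<p}" if i: "i \<in> {1..D}" for i
  proof (rule inj_onI)
    fix j k assume jk: "j \<in> {..<p}" "k \<in> {..<p}" "\<tau> i j = \<tau> i k"
    obtain e where e: "e \<in> edges B" "edge_color B e = i" "white_end B e = a j" "black_end B e = b (\<tau> i j)"
      using \<tau>[OF i, of j] jk by auto
    obtain e' where e': "e' \<in> edges B" "edge_color B e' = i" "white_end B e' = a k" "black_end B e' = b (\<tau> i k)"
      using \<tau>[OF i, of k] jk by auto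
    have "e = e'" using e e' jk by (intro colored_graph_unique_edge[OF B(1,2)]) auto
    then have "a j = a k" using e(3) e'(3) by simp
    then show "j = k" using jk a_eq by simp
  qed
  let ?R = "\<Union>i\<in>{1..D}. \<Union>l\<in>{..<p}. {(l, \<tau> i l), (\<tau> i l, l)}"
  \<comment> \<open>Merging \<open>a j\<close> and \<open>b j\<close> into \<open>j\<close> sends
    adjacent vertices to related indices, so paths of the bubble become the chains that transitivity
    asks for.\<close>
  define index where "index v = (if v \<in> white B then inv_into {..<p} a v else inv_into {..<p} b v)" for v
  have index_a: "index (a j) = j" if "j < p" for j
    using that a bij_betwE[OF a] by (auto simp: index_def bij_betw_def)
  have index_b: "index (b j) = j" if "j < p" for j
    using that b bij_betwE[OF b] fin(3) by (auto simp: index_def bij_betw_def)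
  have adj: "(index u, index v) \<in> ?R" if uv: "(u, v) \<in> adjacency B" for u v
  proof -
    obtain e where e: "e \<in> edges B"
        "(u = white_end B e \<and> v = black_end B e) \<or> (v = white_end B e \<and> u = black_end B e)"
      using uv by (auto simp: adjacency_def)
    obtain j where j: "j < p" "white_end B e = a j"
      using ends(1)[OF e(1)] bij_betw_imp_surj_on[OF a] by blast
    have i: "edge_color B e \<in> {1..D}" using ends e by blast
    have "index (white_end B e) = j" "index (black_end B e) = \<tau> (edge_color B e) j"
      using j index_a index_b \<tau>_edge[OF e(1) j(2,1)] \<tau>[OF i j(1)] by auto
    then show ?thesis using e(2) i j(1) by blast
  qed
  have path: "(index u, index v) \<in> ?R\<^sup>*" if "(u, v) \<in> (adjacency B)\<^sup>*" for u v
    using that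
  proof induction
    case (step y z)
    show ?case by (rule rtrancl_into_rtrancl[OF step.IH adj[OF step.hyps(2)]])
  qed simp
  interpret star D p \<tau>
  proof
    show "bij_betw (\<tau> i) {..<p} {..<p}" if "i \<in> {1..D}" for i
      using inj[OF that] \<tau>[OF that] endo_inj_surj[of "{..<p}" "\<tau> i"] by (force simp: bij_betw_def)
    show "(j, k) \<in> ?R\<^sup>*" if "j < p" "k < p" for j k
    proof -
      have "a j \<in> white B" "a k \<in> white B" using that bij_betwE[OF a] by auto
      then have "(a j, a k) \<in> (adjacency B)\<^sup>*" using B(5) by (simp add: connected_cgraph_def)
      from path[OF this] show ?thesis using that by (simp add: index_a)
    qed
  qed
  interpret colored_map D M by unfold_locales (rule edge_colored_map)
  let ?G = "boundary_graph D M"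
  let ?v = "\<lambda>j. vertex_of M (prod_encode (j, 0))"
  have cilia: "cilia M = (\<lambda>j. prod_encode (j, 0)) ` {..<p}" by (auto simp: star_map_sets)
  have v: "bij_betw ?v {..<p} (ciliated_vertices M)"
    using bij_betw_trans[of "\<lambda>j. prod_encode (j, 0)" "{..<p}" "cilia M", OF _ bij_betw_vertex_of]
    by (auto simp: cilia bij_betw_def inj_on_def o_def)
  define idx where "idx = inv_into {..<p} ?v"
  have idx: "bij_betw idx (ciliated_vertices M) {..<p}"
    unfolding idx_def using v by (rule bij_betw_inv_into)
  have idx_v: "idx (?v j) = j" if "j < p" for j
    unfolding idx_def using that bij_betw_inv_into_left[OF v] by simp
  \<comment> \<open>The two copies of the \<open>j\<close>-th ciliated vertex go to
    \<open>a j\<close> and \<open>b j\<close>, so the pairing induced by the cilia becomes the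
    chosen one.\<close>
  define f where "f u = (case u of White V \<Rightarrow> a (idx V) | Black V \<Rightarrow> b (idx V))" for u
  have "?G \<simeq>\<^sub>c B"
  proof (rule cgraph_isoI[where f = f])
    show "bij_betw f (white ?G) (white B)"
      using bij_betw_trans[OF idx a]
      by (auto simp: boundary_graph_simps bij_betw_def inj_on_def f_def image_image)
    show "bij_betw f (black ?G) (black B)"
      using bij_betw_trans[OF idx b]
      by (auto simp: boundary_graph_simps bij_betw_def inj_on_def f_def image_image)
    fix e assume "e \<in> edges ?G"
    then obtain i j where ij: "i \<in> {1..D}" "j < p" "e = edge_at i (prod_encode (j, 0))"
      by (auto simp: boundary_graph_simps boundary_edges_eq cilia)
    then have "f (white_end ?G e) = a j" "f (black_end ?G e) = b (\<tau> i j)" "edge_color ?G e = i"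
      using \<tau>[OF ij(1,2)] by (simp_all add: boundary_edge_at next_cilium_star f_def idx_v)
    then show "\<exists>e'\<in>edges B. white_end B e' = f (white_end ?G e) \<and>
        black_end B e' = f (black_end ?G e) \<and> edge_color B e' = edge_color ?G e"
      using \<tau>[OF ij(1,2)] by metis
  qed (fact colored_graph_boundary color_regular_boundary B)+
  moreover have "M \<in> edge_colored_maps D p"
    using edge_colored_map card_cilia by (simp add: edge_colored_maps_def)
  ultimately show ?thesis by blast
qed

text \<open>The second half speaks of regular graphs rather than bubbles because a connected map may
  have a disconnected boundary: join two ciliated vertices to a third vertex without cilium by edges
  of two different colors.\<close>

theorem theorem2:
  fixes D p :: nat
  assumes "D \<ge> 2" and "p \<ge> 1"
  shows "(\<forall>B \<in> (bubbles D p :: ('v, 'e) cgraph set).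
            \<exists>M \<in> (edge_colored_maps D p :: nat cmap set). boundary_graph D M \<simeq>\<^sub>c B) \<and>
         (\<forall>M \<in> (edge_colored_maps D p :: 'd cmap set).
            boundary_graph D M \<in> regular_graphs D p \<and>
            is_pairing (boundary_graph D M) (induced_pairing M) \<and>
            bij_betw (cilium_pair M) (cilia M) (induced_pairing M))"
proof (intro conjI ballI)
  fix B :: "('v, 'e) cgraph" assume "B \<in> bubbles D p"
  then show "\<exists>M \<in> (edge_colored_maps D p :: nat cmap set). boundary_graph D M \<simeq>\<^sub>c B"
    by (rule bubble_is_boundary)
next
  fix M :: "'d cmap" assume M: "M \<in> edge_colored_maps D p"
  then interpret colored_map D M by unfold_locales (simp add: edge_colored_maps_def)
  show "boundary_graph D M \<in> regular_graphs D p"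
    using boundary_graph_regular M by (simp add: edge_colored_maps_def)
  show "is_pairing (boundary_graph D M) (induced_pairing M)" by (rule is_pairing_induced)
  show "bij_betw (cilium_pair M) (cilia M) (induced_pairing M)" by (rule cilium_pair_bij_betw)
qed

end
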